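(* Fix integers $t \ge 1$ and, for each $i = 1, \ldots, t$, an integer $d(i) \ge 1$ and integers $1 < a_{2,i} < a_{3,i} < \cdots < a_{d(i),i}$. For each $k \ge \max_i d(i)$, let $f_k(x_1, \ldots, x_k)$ be the rotation symmetric Boolean function in $k$ variables generated by the sum of the $t$ monomials $x_1 x_{a_{2,i}} \cdots x_{a_{d(i),i}}$, $1 \le i \le t$, and let $w_k = wt(f_k)$. Then the sequence $\{w_k : k = \max_i d(i), \max_i d(i)+1, \ldots\}$ satisfies a homogeneous linear recursion with integer coefficients: there exist an integer $L \ge 1$ and integers $c_1, \ldots, c_L$ such that $w_k = c_1 w_{k-1} + c_2 w_{k-2} + \cdots + c_L w_{k-L}$ for all $k \ge \max_i d(i) + L$.
   Context: A Boolean function in $k$ variables is a map $GF(2)^k \to GF(2)$; it is identified with its algebraic normal form (a polynomial over $GF(2)$ in $x_1,\dots,x_k$ with $x_j^2 = x_j$). The Hamming weight $wt(f)$ is the number of $x \in GF(2)^k$ with $f(x) = 1$. Let $\rho(x_1, \ldots, x_k) = (x_2, \ldots, x_k, x_1)$; $f$ is rotation symmetric if $f(\rho(x)) = f(x)$ for all $x$. The rotation symmetric function in $k$ variables generated by a monomial $x_1 x_{a_2} \cdots x_{a_d}$ is the sum (mod 2) of the distinct monomials in its orbit under the cyclic shifts of indices $x_j \mapsto x_{j+1}$, indices taken mod $k$ in $\{1, \ldots, k\}$; the function generated by a sum of monomials is the sum (mod 2) of the functions generated by each monomial. *)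

theory Defs
  imports "HOL-Library.FuncSet" "HOL-Library.Z2"
begin

text \<open>
  \<open>GF(2)\<close> is the type \<^typ>\<open>bit\<close>. A point of \<open>GF(2)^k\<close> is an extensional function on
  \<open>{1..k}\<close>, so distinct points are distinct functions and \<open>cube k\<close> has \<open>2 ^ k\<close> elements.
\<close>

definition cube :: "nat \<Rightarrow> (nat \<Rightarrow> bit) set" where
  "cube k = {1..k} \<rightarrow>\<^sub>E UNIV"

definition wt :: "nat \<Rightarrow> ((nat \<Rightarrow> bit) \<Rightarrow> bit) \<Rightarrow> nat" where
  "wt k f = card {x \<in> cube k. f x = 1}"

definition rot :: "nat \<Rightarrow> (nat \<Rightarrow> bit) \<Rightarrow> nat \<Rightarrow> bit" where
  "rot k x = (\<lambda>j\<in>{1..k}. if j = k then x 1 else x (j + 1))"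

definition rotation_symmetric :: "nat \<Rightarrow> ((nat \<Rightarrow> bit) \<Rightarrow> bit) \<Rightarrow> bool" where
  "rotation_symmetric k f \<longleftrightarrow> (\<forall>x \<in> cube k. f (rot k x) = f x)"

text \<open>
  Because \<open>x\<^sub>j\<^sup>2 = x\<^sub>j\<close>, a monomial is determined by the finite set of its indices.
\<close>

definition monom_fun :: "nat set \<Rightarrow> (nat \<Rightarrow> bit) \<Rightarrow> bit" where
  "monom_fun S x = (\<Prod>j\<in>S. x j)"

text \<open>
  The representative of a positive index modulo \<open>k\<close> in \<open>{1..k}\<close>. An index of the generating
  monomial may exceed \<open>k\<close>; two indices that agree modulo \<open>k\<close> then contribute the same variable,
  which is counted once.
\<close>

definition idx :: "nat \<Rightarrow> nat \<Rightarrow> nat" where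
  "idx k j = (j - 1) mod k + 1"

definition shift :: "nat \<Rightarrow> nat set \<Rightarrow> nat set" where
  "shift k S = (\<lambda>j. idx k (j + 1)) ` S"

text \<open>
  The orbit is a set, so that the distinct monomials of a short orbit are each counted once.
\<close>

definition orbit :: "nat \<Rightarrow> nat set \<Rightarrow> nat set set" where
  "orbit k S = range (\<lambda>s. (shift k ^^ s) (idx k ` S))"

definition rs_monom :: "nat \<Rightarrow> nat set \<Rightarrow> (nat \<Rightarrow> bit) \<Rightarrow> bit" where
  "rs_monom k S x = (\<Sum>T\<in>orbit k S. monom_fun T x)"

text \<open>
  The generating monomials are given as a family rather than a set: repeated or equivalent ones
  are added modulo 2.
\<close>

definition rs_fun :: "nat \<Rightarrow> nat \<Rightarrow> (nat \<Rightarrow> nat set) \<Rightarrow> (nat \<Rightarrow> bit) \<Rightarrow> bit" where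
  "rs_fun k t S x = (\<Sum>i=1..t. rs_monom k (S i) x)"

text \<open>The index set of \<open>x\<^sub>1 x\<^bsub>a 2 i\<^esub> \<dots> x\<^bsub>a (d i) i\<^esub>\<close>.\<close>

definition gen_monom :: "(nat \<Rightarrow> nat) \<Rightarrow> (nat \<Rightarrow> nat \<Rightarrow> nat) \<Rightarrow> nat \<Rightarrow> nat set" where
  "gen_monom d a i = insert 1 ((\<lambda>j. a j i) ` {2..d i})"

lemma orbit_subset:
  assumes "k \<ge> 1"
  shows "orbit k S \<subseteq> Pow {1..k}"
proof -
  have idx: "idx k j \<in> {1..k}" for j
    using assms by (simp add: idx_def Suc_leI)
  have "(shift k ^^ s) (idx k ` S) \<subseteq> {1..k}" for s
    using idx by (cases s) (auto simp: shift_def)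
  then show ?thesis by (auto simp: orbit_def)
qed

lemma rotation_symmetric_rs_monom:
  assumes "k \<ge> 1"
  shows "rotation_symmetric k (rs_monom k S)"
  unfolding rotation_symmetric_def
proof
  fix x assume "x \<in> cube k"
  let ?O = "orbit k S" and ?n = "\<lambda>j. idx k (j + 1)"
  have step: "?n j = (if j = k then 1 else j + 1)" if "j \<in> {1..k}" for j
  proof (cases "j = k")
    case False
    then have "j mod k = j" using that by (intro mod_less) simp
    then show ?thesis using False by (simp add: idx_def)
  qed (simp add: idx_def)
  have inj: "inj_on ?n {1..k}"
  proof (rule inj_onI)
    fix i j assume ij: "i \<in> {1..k}" "j \<in> {1..k}" and eq: "?n i = ?n j"
    have "(if i = k then 1 else i + 1) = (if j = k then 1 else j + 1)"
      using eq by (simp only: step[OF ij(1)] step[OF ij(2)])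
    moreover have "i \<noteq> 0" "j \<noteq> 0" using ij by simp_all
    ultimately show "i = j" by presburger
  qed
  have finO: "finite ?O"
    by (rule finite_subset[OF orbit_subset[OF assms]]) simp
  have injO: "inj_on (shift k) ?O"
  proof -
    have "shift k = image ?n"
      by (rule ext) (rule shift_def)
    then have "inj_on (shift k) (Pow {1..k})"
      using inj_on_image_Pow[OF inj] by metis
    then show ?thesis by (rule inj_on_subset) (rule orbit_subset[OF assms])
  qed
  have "shift k T \<in> ?O" if T: "T \<in> ?O" for T
  proof -
    obtain s where "T = (shift k ^^ s) (idx k ` S)"
      using T by (auto simp: orbit_def)
    then have "shift k T = (shift k ^^ Suc s) (idx k ` S)" by simp
    then show ?thesis unfolding orbit_def by blast
  qed
  then have img: "shift k ` ?O = ?O"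
    by (intro endo_inj_surj finO injO) blast
  have mono: "monom_fun T (rot k x) = monom_fun (shift k T) x" if "T \<in> ?O" for T
  proof -
    have T: "T \<subseteq> {1..k}" using that orbit_subset[OF assms] by blast
    have "monom_fun (shift k T) x = (\<Prod>j\<in>T. x (?n j))"
      unfolding monom_fun_def shift_def
      using prod.reindex[OF inj_on_subset[OF inj T], of x] by (simp add: o_def)
    also have "\<dots> = monom_fun T (rot k x)"
      unfolding monom_fun_def
    proof (rule prod.cong)
      fix j assume "j \<in> T"
      then have "j \<in> {1..k}" using T by blast
      then show "x (?n j) = rot k x j"
        unfolding step[OF \<open>j \<in> {1..k}\<close>] by (simp add: rot_def)
    qed simp
    finally show ?thesis by simp
  qed
  have "rs_monom k S (rot k x) = (\<Sum>T\<in>?O. monom_fun (shift k T) x)"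
    unfolding rs_monom_def by (rule sum.cong) (simp_all add: mono)
  also have "\<dots> = (\<Sum>T\<in>shift k ` ?O. monom_fun T x)"
    by (simp add: sum.reindex[OF injO])
  also have "\<dots> = rs_monom k S x"
    by (simp add: img rs_monom_def)
  finally show "rs_monom k S (rot k x) = rs_monom k S x" .
qed

lemma rotation_symmetric_rs_fun:
  "k \<ge> 1 \<Longrightarrow> rotation_symmetric k (rs_fun k t S)"
  using rotation_symmetric_rs_monom[of k]
  by (simp add: rotation_symmetric_def rs_fun_def)

end

theory Submission
  imports Defs "HOL-Number_Theory.Cong" "Jordan_Normal_Form.Char_Poly"
begin

text \<open>
  Let all indices of the generating monomials be at most \<open>m\<close>. For \<open>k \<ge> 2 m\<close> every orbit has exactly
  \<open>k\<close> elements, so \<open>f\<^sub>k(x)\<close> is the sum of a fixed function \<open>g\<close> over the \<open>k\<close> cyclic windows of length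
  \<open>m\<close> in \<open>x\<close>. Reading \<open>x\<close> letter by letter and remembering the current window together with the partial
  sum of \<open>g\<close>, the weight \<open>w\<^sub>k\<close> is a sum of entries of the \<open>k\<close>-th power of a fixed integer transfer
  matrix, hence is annihilated by the characteristic polynomial of that matrix. The values at small \<open>k\<close> are
  absorbed by enlarging the length of the recursion with zero coefficients.
\<close>

section \<open>Linear systems of sequences\<close>

text \<open>The action of polynomials on sequences in which the indeterminate acts as the shift: a
  sequence killed by \<open>p\<close> obeys the linear recursion with the coefficients of
  \<open>p\<close>.\<close>

definition shift_apply :: "'a::comm_ring_1 poly \<Rightarrow> (nat \<Rightarrow> 'a) \<Rightarrow> nat \<Rightarrow> 'a" where
  "shift_apply p f k = (\<Sum>l\<le>degree p. coeff p l * f (k + l))"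

lemma shift_apply_eq_sum:
  assumes "degree p \<le> n"
  shows "shift_apply p f k = (\<Sum>l\<le>n. coeff p l * f (k + l))"
  unfolding shift_apply_def
  by (rule sum.mono_neutral_left) (use assms in \<open>auto simp: coeff_eq_0\<close>)

lemma shift_apply_0 [simp]: "shift_apply 0 f k = 0"
  by (simp add: shift_apply_def)

lemma shift_apply_1 [simp]: "shift_apply 1 f k = f k"
  by (simp add: shift_apply_def)

lemma shift_apply_zero_seq [simp]: "shift_apply p (\<lambda>_. 0) k = 0"
  by (simp add: shift_apply_def)

lemma shift_apply_pCons [simp]: "shift_apply (pCons a p) f k = a * f k + shift_apply p f (Suc k)"
proof -
  have "shift_apply (pCons a p) f k = (\<Sum>l\<le>Suc (degree p). coeff (pCons a p) l * f (k + l))"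
    by (rule shift_apply_eq_sum) (rule degree_pCons_le)
  also have "\<dots> = a * f k + (\<Sum>l\<le>degree p. coeff p l * f (Suc k + l))"
    by (simp add: sum.atMost_Suc_shift del: sum.atMost_Suc)
  finally show ?thesis by (simp add: shift_apply_def)
qed

lemma shift_apply_add: "shift_apply (p + q) f k = shift_apply p f k + shift_apply q f k"
proof -
  let ?n = "max (degree p) (degree q)"
  have "degree (p + q) \<le> ?n" "degree p \<le> ?n" "degree q \<le> ?n"
    by (auto intro: degree_add_le)
  then show ?thesis
    by (simp only: shift_apply_eq_sum coeff_add distrib_right sum.distrib)
qed

lemma shift_apply_smult: "shift_apply (Polynomial.smult a p) f k = a * shift_apply p f k"
  by (subst shift_apply_eq_sum[OF degree_smult_le])
    (simp add: shift_apply_def sum_distrib_left mult.assoc)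

text \<open>In \<open>pCons a p\<close> the indeterminate advances the argument by one, hence the
  induction with \<open>k\<close> arbitrary. Sequences thus form a module over the polynomial ring,
  and matrices of polynomials may be multiplied before they act.\<close>

lemma shift_apply_mult: "shift_apply (p * q) f k = shift_apply p (shift_apply q f) k"
  by (induction p arbitrary: k) (simp_all add: shift_apply_add shift_apply_smult)

lemma shift_apply_sum: "shift_apply (\<Sum>i\<in>A. p i) f k = (\<Sum>i\<in>A. shift_apply (p i) f k)"
  by (induction A rule: infinite_finite_induct) (simp_all add: shift_apply_add)

lemma shift_apply_sum_seq:
  "shift_apply p (\<lambda>k. \<Sum>i\<in>A. f i k) k = (\<Sum>i\<in>A. shift_apply p (f i) k)"
  unfolding shift_apply_def sum_distrib_left by (rule sum.swap)

text \<open>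
  The system says that the matrix \<open>X I - A\<close> over the polynomial ring, acting by shifts, kills
  the vector of sequences; multiplying by the adjugate, so does its determinant.
\<close>

lemma linear_system_nat_recurrence:
  fixes A :: "'a::comm_ring_1 mat"
  assumes A: "A \<in> carrier_mat n n"
    and F: "\<And>i k. i < n \<Longrightarrow> F i (Suc k) = (\<Sum>j<n. A $$ (i, j) * F j k)"
    and i: "i < n"
  shows "shift_apply (char_poly A) (F i) k = 0"
proof -
  let ?M = "char_poly_matrix A"
  let ?B = "adj_mat ?M"
  have M: "?M \<in> carrier_mat n n" using A by simp
  note B = adj_mat(1)[OF M] and BM = adj_mat(3)[OF M]
  have kill: "(\<Sum>j<n. shift_apply (?M $$ (r, j)) (F j) k) = 0" if r: "r < n" for r k
  proof -
    have entry: "shift_apply (?M $$ (r, j)) (F j) k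
        = (if j = r then F r (Suc k) else 0) - A $$ (r, j) * F j k" if "j < n" for j
      using A r that by (simp add: char_poly_matrix_def)
    have "(\<Sum>j<n. shift_apply (?M $$ (r, j)) (F j) k)
        = F r (Suc k) - (\<Sum>j<n. A $$ (r, j) * F j k)"
      using r by (simp add: entry sum_subtractf)
    then show ?thesis using F[OF r] by simp
  qed
  \<comment> \<open>The same entry is read in two ways: as a combination of the rows of
    \<open>?M\<close>, each of which kills the sequences, and as an entry of the determinant times
    the identity.\<close>
  have BM_entry: "(?B * ?M) $$ (i, j) = (\<Sum>r<n. ?B $$ (i, r) * ?M $$ (r, j))" if "j < n" for j
    using that i B M by (simp add: scalar_prod_def atLeast0LessThan)
  have det_entry: "(?B * ?M) $$ (i, j) = (if j = i then char_poly A else 0)" if "j < n" for j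
    using that i by (simp add: BM char_poly_def)
  have "shift_apply (char_poly A) (F i) k = (\<Sum>j<n. shift_apply ((?B * ?M) $$ (i, j)) (F j) k)"
    using i by (simp add: det_entry if_distrib[of "\<lambda>p. shift_apply p _ _"] cong: if_cong)
  also have "\<dots> = (\<Sum>j<n. \<Sum>r<n. shift_apply (?B $$ (i, r)) (shift_apply (?M $$ (r, j)) (F j)) k)"
    by (simp add: BM_entry shift_apply_sum shift_apply_mult)
  also have "\<dots> = (\<Sum>r<n. shift_apply (?B $$ (i, r)) (\<lambda>k. \<Sum>j<n. shift_apply (?M $$ (r, j)) (F j) k) k)"
    unfolding shift_apply_sum_seq by (rule sum.swap)
  also have "\<dots> = 0" by (simp add: kill)
  finally show ?thesis .
qed

text \<open>An enumeration \<open>e\<close> of \<open>I\<close> reduces this to indices below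
  \<open>card I\<close>. The polynomial depends on \<open>A\<close> alone and therefore precedes
  \<open>F\<close>: a single one serves all solutions of the system.\<close>

lemma linear_system_recurrence:
  fixes A :: "'i \<Rightarrow> 'i \<Rightarrow> 'a::comm_ring_1"
  assumes "finite I"
  shows "\<exists>p. degree p = card I \<and> coeff p (card I) = 1 \<and>
    (\<forall>F. (\<forall>i\<in>I. \<forall>k. F i (Suc k) = (\<Sum>j\<in>I. A i j * F j k))
      \<longrightarrow> (\<forall>i\<in>I. \<forall>k. shift_apply p (F i) k = 0))"
proof -
  let ?n = "card I"
  obtain e where e: "bij_betw e {..<?n} I"
    using ex_bij_betw_nat_finite[OF assms] by (auto simp: atLeast0LessThan)
  let ?A = "mat ?n ?n (\<lambda>(r, s). A (e r) (e s))"
  have A: "?A \<in> carrier_mat ?n ?n" by simp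
  show ?thesis
  proof (intro exI conjI allI impI ballI)
    show "degree (char_poly ?A) = ?n" "coeff (char_poly ?A) ?n = 1"
      using degree_monic_char_poly[OF A] by simp_all
  next
    fix F :: "'i \<Rightarrow> nat \<Rightarrow> 'a" and i k
    assume F: "\<forall>i\<in>I. \<forall>k. F i (Suc k) = (\<Sum>j\<in>I. A i j * F j k)" and "i \<in> I"
    from \<open>i \<in> I\<close> have "i \<in> e ` {..<?n}" using e by (simp add: bij_betw_def)
    then obtain r where r: "r < ?n" "i = e r" by auto
    have "F (e r) (Suc k) = (\<Sum>s<?n. ?A $$ (r, s) * F (e s) k)" if "r < ?n" for r k
    proof -
      have "e r \<in> I" using e that by (auto simp: bij_betw_def)
      then have "F (e r) (Suc k) = (\<Sum>j\<in>I. A (e r) j * F j k)" using F by blast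
      also have "\<dots> = (\<Sum>s<?n. A (e r) (e s) * F (e s) k)"
        by (rule sum.reindex_bij_betw[OF e, symmetric])
      finally show ?thesis using that by simp
    qed
    from linear_system_nat_recurrence[of ?A ?n "\<lambda>r. F (e r)", OF A this r(1)]
    show "shift_apply (char_poly ?A) (F i) k = 0" by (simp add: r(2))
  qed
qed

section \<open>Counting words by their window sums\<close>

text \<open>The window at position \<open>k\<close> is left out: in a walk of \<open>k\<close> steps
  it is the end point, and in an unrolled cyclic word of length \<open>k\<close> it repeats the
  window at \<open>0\<close>.\<close>

definition windows_sum :: "nat \<Rightarrow> ('a list \<Rightarrow> 'b::comm_monoid_add) \<Rightarrow> nat \<Rightarrow> 'a list \<Rightarrow> 'b" where
  "windows_sum m g k xs = (\<Sum>s<k. g (take m (drop s xs)))"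

lemma windows_sum_Suc:
  "windows_sum m g (Suc k) xs = g (take m xs) + windows_sum m g k (tl xs)"
  unfolding windows_sum_def by (simp add: sum.lessThan_Suc_shift drop_Suc del: sum.lessThan_Suc)

text \<open>A word of length \<open>k + m\<close> is a walk of \<open>k\<close> steps through its windows of length \<open>m\<close>.\<close>

definition walks :: "nat \<Rightarrow> ('a list \<Rightarrow> 'b::comm_monoid_add) \<Rightarrow> nat \<Rightarrow> 'a list \<Rightarrow> 'a list \<Rightarrow> 'b \<Rightarrow> 'a list set"
  where "walks m g k u v c =
    {xs. length xs = k + m \<and> take m xs = u \<and> drop k xs = v \<and> windows_sum m g k xs = c}"

lemma finite_lists_of_length: "finite {xs :: 'a::finite list. length xs = n}"
  using finite_lists_length_eq[of "UNIV :: 'a set" n] by simp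

lemma finite_walks [simp]: "finite (walks m g k u v c :: 'a::finite list set)"
  by (rule finite_subset[OF _ finite_lists_of_length[of "k + m"]]) (auto simp: walks_def)

text \<open>Deleting the first letter deletes the first step. The next window \<open>u'\<close>
  overlaps \<open>u\<close> in \<open>m - 1\<close> letters, and the sum still to be collected drops
  by \<open>g u\<close>.\<close>

lemma walks_Suc:
  fixes g :: "'a list \<Rightarrow> 'b::ab_group_add"
  assumes m: "m \<ge> 1" and u: "length u = m"
  shows "walks m g (Suc k) u v c
    = (\<Union>u'\<in>{u'. length u' = m \<and> butlast u' = tl u}. Cons (hd u) ` walks m g k u' v (c - g u))"
proof (intro Set.set_eqI iffI)
  fix xs assume xs: "xs \<in> walks m g (Suc k) u v c"
  then obtain x ys where xs_eq: "xs = x # ys" by (cases xs) (auto simp: walks_def)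
  have ys: "length ys = k + m" "take m (x # ys) = u" "drop k ys = v"
    "g u + windows_sum m g k ys = c"
    using xs by (auto simp: walks_def windows_sum_Suc xs_eq)
  have "x = hd u" "butlast (take m ys) = tl u"
    using m ys(1,2) by (cases m; auto simp: butlast_take)+
  moreover have "ys \<in> walks m g k (take m ys) v (c - g u)"
    using ys by (auto simp: walks_def)
  ultimately show "xs \<in> (\<Union>u'\<in>{u'. length u' = m \<and> butlast u' = tl u}. Cons (hd u) ` walks m g k u' v (c - g u))"
    using ys(1) by (intro UN_I[of "take m ys"]) (auto simp: xs_eq)
next
  fix xs assume "xs \<in> (\<Union>u'\<in>{u'. length u' = m \<and> butlast u' = tl u}. Cons (hd u) ` walks m g k u' v (c - g u))"
  then obtain u' ys where ys: "xs = hd u # ys" "butlast u' = tl u" "ys \<in> walks m g k u' v (c - g u)"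
    by auto
  obtain n where n: "m = Suc n" using m by (cases m) auto
  \<comment> \<open>The window \<open>u'\<close> is \<open>take m ys\<close>, so dropping its last
    letter leaves \<open>take n ys\<close>.\<close>
  have "take n ys = tl u"
    using ys(2,3) by (auto simp: walks_def n butlast_take)
  then have "take m xs = u"
    using u ys(1) n by (cases u) auto
  then show "xs \<in> walks m g (Suc k) u v c"
    using ys by (auto simp: walks_def windows_sum_Suc)
qed

text \<open>The union is disjoint because a walk determines its first window \<open>u'\<close>. The
  counts thus satisfy a linear system in which the end point \<open>v\<close> stays fixed.\<close>

lemma card_walks_Suc:
  fixes g :: "'a::finite list \<Rightarrow> 'b::ab_group_add"
  assumes m: "m \<ge> 1" and u: "length u = m"
  shows "card (walks m g (Suc k) u v c)
    = (\<Sum>u'\<in>{u'. length u' = m \<and> butlast u' = tl u}. card (walks m g k u' v (c - g u)))"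
proof -
  have "card (walks m g (Suc k) u v c)
    = (\<Sum>u'\<in>{u'. length u' = m \<and> butlast u' = tl u}. card (Cons (hd u) ` walks m g k u' v (c - g u)))"
    unfolding walks_Suc[OF m u]
  proof (rule card_UN_disjoint)
    show "finite {u' :: 'a list. length u' = m \<and> butlast u' = tl u}"
      by (rule finite_subset[OF _ finite_lists_of_length[of m]]) auto
    show "\<forall>u'\<in>{u'. length u' = m \<and> butlast u' = tl u}. finite (Cons (hd u) ` walks m g k u' v (c - g u))"
      by simp
  qed (auto simp: walks_def)
  then show ?thesis by (simp add: card_image)
qed

section \<open>Cyclic words as closed walks\<close>

definition cyclic_words :: "nat \<Rightarrow> ('a list \<Rightarrow> 'b::comm_monoid_add) \<Rightarrow> nat \<Rightarrow> 'b \<Rightarrow> 'a list set" where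
  "cyclic_words m g k c = {ys. length ys = k \<and> windows_sum m g k (ys @ take m ys) = c}"

text \<open>Appending the first \<open>m\<close> letters unrolls a cyclic word: its \<open>k\<close>
  cyclic windows become ordinary ones, and the result is a walk that returns to its first window.
  The bound \<open>k \<ge> m\<close> places that window inside the word itself.\<close>

lemma card_cyclic_words:
  fixes g :: "'a::finite list \<Rightarrow> 'b::ab_group_add"
  assumes "k \<ge> m"
  shows "card (cyclic_words m g k c) = (\<Sum>v\<in>{v. length v = m}. card (walks m g k v v c))"
proof -
  have "bij_betw (\<lambda>ys. ys @ take m ys) (cyclic_words m g k c)
    (\<Union>v\<in>{v. length v = m}. walks m g k v v c)"
  proof (rule bij_betw_byWitness[where f' = "take k"])
    show "\<forall>ys\<in>cyclic_words m g k c. take k (ys @ take m ys) = ys"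
      by (simp add: cyclic_words_def)
    \<comment> \<open>The last \<open>m\<close> letters of a closed walk repeat its first
      \<open>m\<close>, which lie among the first \<open>k\<close>.\<close>
    show restore: "\<forall>xs\<in>\<Union>v\<in>{v. length v = m}. walks m g k v v c. take k xs @ take m (take k xs) = xs"
    proof
      fix xs assume "xs \<in> (\<Union>v\<in>{v. length v = m}. walks m g k v v c)"
      then have "take m xs = drop k xs" by (auto simp: walks_def)
      then show "take k xs @ take m (take k xs) = xs"
        using assms by (simp add: min_absorb1)
    qed
    show "(\<lambda>ys. ys @ take m ys) ` cyclic_words m g k c \<subseteq> (\<Union>v\<in>{v. length v = m}. walks m g k v v c)"
      using assms by (auto simp: walks_def cyclic_words_def)
    show "take k ` (\<Union>v\<in>{v. length v = m}. walks m g k v v c) \<subseteq> cyclic_words m g k c"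
    proof (rule image_subsetI)
      fix xs assume xs: "xs \<in> (\<Union>v\<in>{v. length v = m}. walks m g k v v c)"
      then have "windows_sum m g k (take k xs @ take m (take k xs)) = c"
        by (subst bspec[OF restore xs]) (auto simp: walks_def)
      then show "take k xs \<in> cyclic_words m g k c"
        using xs by (auto simp: walks_def cyclic_words_def)
    qed
  qed
  then have "card (cyclic_words m g k c) = card (\<Union>v\<in>{v. length v = m}. walks m g k v v c)"
    by (rule bij_betw_same_card)
  also have "\<dots> = (\<Sum>v\<in>{v. length v = m}. card (walks m g k v v c))"
  proof (rule card_UN_disjoint)
    show "\<forall>v\<in>{v. length v = m}. finite (walks m g k v v c)" by simp
  qed (auto simp: finite_lists_of_length walks_def)
  finally show ?thesis .
qed

theorem card_cyclic_words_recurrence: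
  fixes g :: "'a::finite list \<Rightarrow> 'b::{finite, ab_group_add}"
  assumes m: "m \<ge> 1"
  obtains p :: "int poly" where "degree p \<ge> 1" "coeff p (degree p) = 1"
    "\<And>k. k \<ge> m \<Longrightarrow> shift_apply p (\<lambda>k. int (card (cyclic_words m g k c))) k = 0"
proof -
  define I where "I = {u :: 'a list. length u = m} \<times> (UNIV :: 'b set)"
  \<comment> \<open>A state is a window together with the sum still to be collected, so a step away
    from \<open>u\<close> leaves \<open>c - g u\<close>.\<close>
  define A where "A = (\<lambda>(u, c) (u', c'). of_bool (butlast u' = tl u \<and> c' = c - g u) :: int)"
  have fin: "finite I" by (simp add: I_def finite_lists_of_length)
  obtain p where p: "degree p = card I" "coeff p (card I) = 1"
    and kill: "\<forall>F. (\<forall>i\<in>I. \<forall>k. F i (Suc k) = (\<Sum>j\<in>I. A i j * F j k))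
      \<longrightarrow> (\<forall>i\<in>I. \<forall>k. shift_apply p (F i) k = 0)"
    using linear_system_recurrence[OF fin, of A] by (elim exE conjE)
  \<comment> \<open>For each end point \<open>v\<close> the counts solve the same system, so
    \<open>p\<close> kills every \<open>F v\<close>, in particular the closed walks
    \<open>F v (v, c)\<close> that are summed over \<open>v\<close>.\<close>
  define F where "F = (\<lambda>v (u, c) k. int (card (walks m g k u v c)))"
  have step: "F v i (Suc k) = (\<Sum>j\<in>I. A i j * F v j k)" if i_in: "i \<in> I" for v i k
  proof -
    obtain u c where i: "i = (u, c)" "length u = m" using i_in by (auto simp: I_def)
    have "(\<Sum>j\<in>I. A i j * F v j k)
      = (\<Sum>u'\<in>{u'. length u' = m}. \<Sum>c'\<in>UNIV. A i (u', c') * F v (u', c') k)"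
      by (simp add: I_def sum.cartesian_product)
    also have "\<dots> = (\<Sum>u'\<in>{u'. length u' = m}. of_bool (butlast u' = tl u) * F v (u', c - g u) k)"
    proof (rule sum.cong)
      fix u' :: "'a list"
      have "(\<Sum>c'\<in>UNIV. A i (u', c') * F v (u', c') k)
        = (\<Sum>c'\<in>UNIV. if c' = c - g u then of_bool (butlast u' = tl u) * F v (u', c') k else 0)"
        by (rule sum.cong) (auto simp: A_def i)
      then show "(\<Sum>c'\<in>UNIV. A i (u', c') * F v (u', c') k)
        = of_bool (butlast u' = tl u) * F v (u', c - g u) k" by simp
    qed simp
    also have "\<dots> = (\<Sum>u'\<in>{u'. length u' = m \<and> butlast u' = tl u}. F v (u', c - g u) k)"
      by (rule sum.mono_neutral_cong_right) (auto simp: finite_lists_of_length)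
    also have "\<dots> = F v i (Suc k)"
      by (simp add: F_def i card_walks_Suc[OF m i(2)])
    finally show ?thesis by simp
  qed
  \<comment> \<open>Some state exists, so the degree \<open>card I\<close> is positive.\<close>
  have "(replicate m undefined, 0) \<in> I" by (simp add: I_def)
  then have "card I \<ge> 1" using fin by (metis One_nat_def Suc_leI card_gt_0_iff empty_iff)
  moreover have "shift_apply p (\<lambda>k. int (card (cyclic_words m g k c))) k = 0" if "k \<ge> m" for k
  proof -
    have "shift_apply p (\<lambda>k. int (card (cyclic_words m g k c))) k
      = shift_apply p (\<lambda>k. \<Sum>v\<in>{v. length v = m}. F v (v, c) k) k"
      unfolding shift_apply_def
      by (rule sum.cong) (use that in \<open>auto simp: F_def card_cyclic_words\<close>)
    also have "\<dots> = (\<Sum>v\<in>{v. length v = m}. shift_apply p (F v (v, c)) k)"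
      by (rule shift_apply_sum_seq)
    also have "\<dots> = 0"
    proof (rule sum.neutral, rule ballI)
      fix v :: "'a list" assume "v \<in> {v. length v = m}"
      then have "(v, c) \<in> I" by (simp add: I_def)
      then show "shift_apply p (F v (v, c)) k = 0"
        using kill[THEN spec, of "F v"] step[of _ v] by blast
    qed
    finally show ?thesis .
  qed
  ultimately show thesis using that[of p] p by simp
qed

section \<open>Rotation symmetric functions\<close>

text \<open>Letters and partial sums both lie in \<open>bit\<close>; its finiteness makes the set of
  states finite.\<close>

instance bit :: finite
proof
  show "finite (UNIV :: bit set)"
    by (rule finite_subset[of _ "{0, 1}"]) (use bit_not_one_iff in auto)
qed

lemma idx_add: "j \<ge> 1 \<Longrightarrow> idx k (idx k j + s) = idx k (j + s)"
  by (simp add: idx_def mod_simps)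

text \<open>Truncated subtraction gives \<open>idx k 0 = idx k 1\<close>, so index \<open>0\<close>
  is excluded for shifts to add up.\<close>

lemma shift_iterate:
  assumes "0 \<notin> S"
  shows "(shift k ^^ s) (idx k ` S) = (\<lambda>j. idx k (j + s)) ` S"
proof (induction s)
  case (Suc s)
  have "idx k (idx k (j + s) + 1) = idx k (j + Suc s)" if "j \<in> S" for j
    using that assms idx_add[of "j + s" k 1] by (cases j) auto
  then have "shift k ((\<lambda>j. idx k (j + s)) ` S) = (\<lambda>j. idx k (j + Suc s)) ` S"
    unfolding shift_def image_image by (rule image_cong[OF refl])
  then show ?case by (simp only: funpow.simps o_apply Suc)
qed simp

text \<open>Shift amounts matter only modulo \<open>k\<close>, so the first \<open>k\<close> shifts
  exhaust the orbit.\<close>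

lemma orbit_eq_image:
  assumes "k \<ge> 1" "0 \<notin> S"
  shows "orbit k S = (\<lambda>s. (\<lambda>j. idx k (j + s)) ` S) ` {..<k}"
proof -
  have "(\<lambda>j. idx k (j + s)) ` S = (\<lambda>j. idx k (j + s mod k)) ` S" for s
  proof (rule image_cong)
    fix j assume "j \<in> S"
    then have "j + s - 1 = j - 1 + s" "j + s mod k - 1 = j - 1 + s mod k"
      using assms(2) by (cases j; simp)+
    then show "idx k (j + s) = idx k (j + s mod k)"
      by (simp add: idx_def mod_simps)
  qed simp
  then have "range (\<lambda>s. (\<lambda>j. idx k (j + s)) ` S)
      = (\<lambda>s. (\<lambda>j. idx k (j + s)) ` S) ` range (\<lambda>s. s mod k)"
    unfolding image_image by (rule image_cong[OF refl])
  moreover have "range (\<lambda>s. s mod k) = {..<k}"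
  proof (intro equalityI subsetI)
    fix s assume "s \<in> {..<k}"
    then show "s \<in> range (\<lambda>s. s mod k)" by (intro range_eqI[of _ _ s]) simp
  qed (use assms(1) in auto)
  ultimately show ?thesis by (simp only: orbit_def shift_iterate[OF assms(2)])
qed

text \<open>Distinct elements of \<open>{1..k}\<close> stay distinct modulo \<open>k\<close> after a
  translation. Hence no variables of a shifted monomial coincide.\<close>

lemma inj_on_idx_shift:
  assumes "S \<subseteq> {1..k}"
  shows "inj_on (\<lambda>j. idx k (j + s)) S"
proof (rule inj_onI)
  fix i j assume ij: "i \<in> S" "j \<in> S" "idx k (i + s) = idx k (j + s)"
  have b: "1 \<le> i" "i \<le> k" "1 \<le> j" "j \<le> k" using ij assms by auto
  then have "[i - 1 + s = j - 1 + s] (mod k)"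
    using ij(3) by (simp add: idx_def cong_def)
  then have "(i - 1) mod k = (j - 1) mod k"
    unfolding cong_add_rcancel_nat by (simp only: cong_def)
  then show "i = j" using b by simp
qed

text \<open>
  If the shifts by \<open>r \<le> s\<close> agree, then \<open>1 \<in> S\<close> forces \<open>s - r < m\<close>. Shifting \<open>S\<close> by so little
  does not wrap around, and comparing maxima gives \<open>s = r\<close>.
\<close>

lemma inj_on_orbit:
  assumes S: "S \<subseteq> {1..m}" "1 \<in> S" and k: "k \<ge> 2 * m"
  shows "inj_on (\<lambda>s. (\<lambda>j. idx k (j + s)) ` S) {..<k}"
proof -
  have "s = r" if rs: "r \<le> s" "s < k"
    and eq: "(\<lambda>j. idx k (j + r)) ` S = (\<lambda>j. idx k (j + s)) ` S" for r s
  proof -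
    define e where "e = s - r"
    \<comment> \<open>Cancelling the common shift \<open>r\<close> shows that translation by
      \<open>e\<close> modulo \<open>k\<close> maps \<open>S\<close>, with its indices counted from
      \<open>0\<close>, into itself.\<close>
    have step: "\<exists>i\<in>S. (j - 1 + e) mod k = i - 1" if j: "j \<in> S" for j
    proof -
      obtain i where i: "i \<in> S" "idx k (j + s) = idx k (i + r)"
        using eq j by (metis (no_types, lifting) imageE imageI)
      have b: "1 \<le> i" "i \<le> k" "1 \<le> j" using i j S k by auto
      then have "j + s - 1 = (j - 1 + e) + r" "i + r - 1 = (i - 1) + r"
        using rs by (simp_all add: e_def)
      then have "[(j - 1 + e) + r = (i - 1) + r] (mod k)"
        using i(2) by (simp add: idx_def cong_def)
      then have "(j - 1 + e) mod k = (i - 1) mod k"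
        unfolding cong_add_rcancel_nat by (simp add: cong_def)
      then show ?thesis using i b by auto
    qed
    obtain i where i: "i \<in> S" "e mod k = i - 1" using step[OF S(2)] by auto
    then have "1 \<le> i" "i \<le> m" using S by auto
    moreover have "e mod k = e" using rs by (simp add: e_def)
    ultimately have e: "e < m" using i(2) by linarith
    have fin: "finite S" using S finite_subset by blast
    define j where "j = Max S"
    have j: "j \<in> S" using Max_in[OF fin] S(2) by (auto simp: j_def)
    then obtain i where i: "i \<in> S" "(j - 1 + e) mod k = i - 1" using step by blast
    \<comment> \<open>Both \<open>j - 1\<close> and \<open>e\<close> are below \<open>m\<close>, so
      \<open>2 * m \<le> k\<close> rules out a reduction modulo \<open>k\<close>.\<close>
    have "j \<le> m" using j S(1) by auto
    then have "j - 1 + e < k" using e k by simp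
    then have "j - 1 + e = i - 1" using i(2) by simp
    moreover have "i \<le> j" using fin i by (simp add: j_def)
    ultimately have "e = 0" by linarith
    then show ?thesis using rs by (simp add: e_def)
  qed
  then show ?thesis by (intro inj_onI) (metis lessThan_iff nle_le)
qed

text \<open>The monomial shifted by \<open>s\<close> is the original one evaluated on the window
  starting at \<open>s\<close>, where variable \<open>j\<close> sits at position
  \<open>j - 1\<close>. As the \<open>k\<close> shifts are distinct, the sum over the orbit is a sum
  over \<open>s < k\<close>.\<close>

lemma rs_monom_eq_windows:
  fixes x :: "nat \<Rightarrow> bit"
  assumes S: "S \<subseteq> {1..m}" "1 \<in> S" and k: "k \<ge> 2 * m"
  defines "ys \<equiv> map x [1..<Suc k]"
  shows "rs_monom k S x = windows_sum m (\<lambda>u. \<Prod>j\<in>S. u ! (j - 1)) k (ys @ take m ys)"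
proof -
  have m: "1 \<le> m" "m \<le> k" using S k by auto
  have nth: "take m (drop s (ys @ take m ys)) ! (j - 1) = x (idx k (j + s))"
    if "s < k" "j \<in> S" for s j
  proof -
    have j: "1 \<le> j" "j \<le> m" using that S by auto
    have "take m (drop s (ys @ take m ys)) ! (j - 1) = (ys @ take m ys) ! (s + (j - 1))"
      using j m that by (simp add: ys_def del: upt_Suc drop_append take_append)
    also have "\<dots> = x (idx k (j + s))"
    proof (cases "s + (j - 1) < k")
      case True
      then show ?thesis using j by (simp add: ys_def nth_append idx_def add.commute del: upt_Suc)
    next
      case False
      \<comment> \<open>The window runs past the end of \<open>ys\<close>; \<open>q\<close> is the
        position reached in the appended copy of its first \<open>m\<close> letters.\<close>
      define q where "q = s + (j - 1) - k"
      have q: "s + (j - 1) = k + q" "q < m" using False j that by (auto simp: q_def)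
      have "j + s - 1 = k + q" using q j by simp
      then show ?thesis using q m by (simp add: ys_def nth_append idx_def del: upt_Suc)
    qed
    finally show ?thesis .
  qed
  have "rs_monom k S x = (\<Sum>s<k. monom_fun ((\<lambda>j. idx k (j + s)) ` S) x)"
    unfolding rs_monom_def using S m
    by (subst orbit_eq_image) (auto simp: sum.reindex[OF inj_on_orbit[OF S k]])
  also have "\<dots> = windows_sum m (\<lambda>u. \<Prod>j\<in>S. u ! (j - 1)) k (ys @ take m ys)"
    unfolding windows_sum_def
  proof (rule sum.cong)
    fix s assume "s \<in> {..<k}"
    have "inj_on (\<lambda>j. idx k (j + s)) S"
      by (rule inj_on_idx_shift) (use S m in auto)
    then have "monom_fun ((\<lambda>j. idx k (j + s)) ` S) x = (\<Prod>j\<in>S. x (idx k (j + s)))"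
      by (simp add: monom_fun_def prod.reindex)
    also have "\<dots> = (\<Prod>j\<in>S. take m (drop s (ys @ take m ys)) ! (j - 1))"
      using nth \<open>s \<in> {..<k}\<close> by (intro prod.cong refl) (metis lessThan_iff)
    finally show "monom_fun ((\<lambda>j. idx k (j + s)) ` S) x
        = (\<Prod>j\<in>S. take m (drop s (ys @ take m ys)) ! (j - 1))" .
  qed simp
  finally show ?thesis .
qed

section \<open>Points of the cube as words\<close>

lemma bij_betw_cube_lists:
  "bij_betw (\<lambda>x. map x [1..<Suc k]) (cube k) {ys. length ys = k}"
proof (rule bij_betw_byWitness[where f' = "\<lambda>ys. \<lambda>j\<in>{1..k}. ys ! (j - 1)"])
  show "\<forall>x\<in>cube k. (\<lambda>j\<in>{1..k}. map x [1..<Suc k] ! (j - 1)) = x"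
  proof (rule ballI, rule HOL.ext)
    fix x j assume x: "x \<in> cube k"
    show "(\<lambda>j\<in>{1..k}. map x [1..<Suc k] ! (j - 1)) j = x j"
    proof (cases "j \<in> {1..k}")
      case True
      then have "j - 1 < k" "1 + (j - 1) = j" by auto
      then have "map x [1..<Suc k] ! (j - 1) = x j"
        by (subst nth_map_upt) simp_all
      then show ?thesis using True by (simp only: restrict_apply if_True)
    next
      case False
      then show ?thesis
        using PiE_arb[OF x[unfolded cube_def] False] by (simp only: restrict_apply if_False)
    qed
  qed
  show "\<forall>ys\<in>{ys :: bit list. length ys = k}. map (\<lambda>j\<in>{1..k}. ys ! (j - 1)) [1..<Suc k] = ys"
  proof
    fix ys :: "bit list" assume "ys \<in> {ys. length ys = k}"
    then show "map (\<lambda>j\<in>{1..k}. ys ! (j - 1)) [1..<Suc k] = ys"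
      by (intro nth_equalityI) (simp_all del: upt_Suc)
  qed
  show "(\<lambda>x. map x [1..<Suc k]) ` cube k \<subseteq> {ys. length ys = k}"
    by (rule image_subsetI) (simp del: upt_Suc)
  show "(\<lambda>ys. \<lambda>j\<in>{1..k}. ys ! (j - 1)) ` {ys. length ys = k} \<subseteq> cube k"
    unfolding cube_def by (intro image_subsetI restrict_PiE_iff[THEN iffD2]) simp
qed

text \<open>Interchanging the sum over the monomials with the sum over the windows merges all
  \<open>t\<close> monomials into one window function.\<close>

lemma wt_rs_fun_eq_card_cyclic_words:
  assumes S: "\<And>i. i \<in> {1..t} \<Longrightarrow> S i \<subseteq> {1..m} \<and> 1 \<in> S i" and k: "k \<ge> 2 * m"
  shows "wt k (rs_fun k t S)
    = card (cyclic_words m (\<lambda>u. \<Sum>i=1..t. \<Prod>j\<in>S i. u ! (j - 1) :: bit) k 1)"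
proof -
  let ?g = "\<lambda>u. \<Sum>i=1..t. \<Prod>j\<in>S i. u ! (j - 1) :: bit"
  define \<phi> :: "(nat \<Rightarrow> bit) \<Rightarrow> bit list" where "\<phi> = (\<lambda>x. map x [1..<Suc k])"
  have bij: "bij_betw \<phi> (cube k) {ys. length ys = k}"
    unfolding \<phi>_def by (rule bij_betw_cube_lists)
  have rs_fun_eq: "rs_fun k t S x = windows_sum m ?g k (\<phi> x @ take m (\<phi> x))" for x
  proof -
    have "rs_fun k t S x
      = (\<Sum>i=1..t. windows_sum m (\<lambda>u. \<Prod>j\<in>S i. u ! (j - 1)) k (\<phi> x @ take m (\<phi> x)))"
      unfolding rs_fun_def
    proof (rule sum.cong[OF refl])
      fix i assume i: "i \<in> {1..t}"
      show "rs_monom k (S i) x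
        = windows_sum m (\<lambda>u. \<Prod>j\<in>S i. u ! (j - 1)) k (\<phi> x @ take m (\<phi> x))"
        unfolding \<phi>_def
        by (rule rs_monom_eq_windows[OF conjunct1[OF S[OF i]] conjunct2[OF S[OF i]] k])
    qed
    also have "\<dots> = windows_sum m ?g k (\<phi> x @ take m (\<phi> x))"
      unfolding windows_sum_def by (rule sum.swap)
    finally show ?thesis .
  qed
  have "cyclic_words m ?g k 1 = {ys \<in> \<phi> ` cube k. windows_sum m ?g k (ys @ take m ys) = 1}"
    using bij_betw_imp_surj_on[OF bij] by (simp add: cyclic_words_def)
  also have "\<dots> = \<phi> ` {x \<in> cube k. windows_sum m ?g k (\<phi> x @ take m (\<phi> x)) = 1}"
    by blast
  also have "{x \<in> cube k. windows_sum m ?g k (\<phi> x @ take m (\<phi> x)) = 1}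
    = {x \<in> cube k. rs_fun k t S x = 1}"
    by (simp only: rs_fun_eq)
  finally show ?thesis
    unfolding wt_def
    using card_image[OF inj_on_subset[OF bij_betw_imp_inj_on[OF bij]],
        of "{x \<in> cube k. rs_fun k t S x = 1}"] by auto
qed

section \<open>From an annihilating polynomial to the recursion\<close>

lemma integer_recursion_of_shift_apply:
  fixes p :: "int poly"
  assumes p: "coeff p (degree p) = 1" "degree p \<ge> 1"
    and kill: "\<And>k. k \<ge> k0 \<Longrightarrow> shift_apply p f k = 0"
  shows "\<exists>L\<ge>1. \<exists>c :: nat \<Rightarrow> int. \<forall>k\<ge>k1 + L. f k = (\<Sum>l=1..L. c l * f (k - l))"
proof (intro exI conjI allI impI)
  let ?n = "degree p"
  let ?L = "?n + k0"
  \<comment> \<open>Since \<open>p\<close> is monic, its relation at \<open>k - ?n\<close> can be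
    solved for \<open>f k\<close> over the integers. The extra \<open>k0\<close> zero coefficients
    ensure \<open>k - ?n \<ge> k0\<close>.\<close>
  let ?c = "\<lambda>l. if l \<le> ?n then - coeff p (?n - l) else 0"
  show "1 \<le> ?L" using p by simp
  fix k assume k: "k1 + ?L \<le> k"
  have "0 = shift_apply p f (k - ?n)" using k by (simp add: kill)
  also have "\<dots> = (\<Sum>l\<le>?n. coeff p (?n - l) * f (k - l))"
    unfolding shift_apply_def
    by (rule sum.reindex_bij_witness[of _ "\<lambda>l. ?n - l" "\<lambda>l. ?n - l"]) (use k in auto)
  also have "\<dots> = f k + (\<Sum>l=1..?n. coeff p (?n - l) * f (k - l))"
    by (simp add: p atMost_atLeast0 sum.atLeast_Suc_atMost)
  finally have "f k = (\<Sum>l=1..?n. ?c l * f (k - l))"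
    by (simp add: sum_negf)
  also have "\<dots> = (\<Sum>l=1..?L. ?c l * f (k - l))"
    by (rule sum.mono_neutral_left) auto
  finally show "f k = (\<Sum>l=1..?L. ?c l * f (k - l))" .
qed

theorem theorem1:
  fixes t :: nat and d :: "nat \<Rightarrow> nat" and a :: "nat \<Rightarrow> nat \<Rightarrow> nat"
  assumes "t \<ge> 1"
    and "\<And>i. i \<in> {1..t} \<Longrightarrow> d i \<ge> 1"
    and "\<And>i j. i \<in> {1..t} \<Longrightarrow> j \<in> {2..d i} \<Longrightarrow> 1 < a j i"
    and "\<And>i. i \<in> {1..t} \<Longrightarrow> strict_mono_on {2..d i} (\<lambda>j. a j i)"
  defines "w \<equiv> \<lambda>k. wt k (rs_fun k t (gen_monom d a))"
  shows "\<exists>L\<ge>1. \<exists>c :: nat \<Rightarrow> int. \<forall>k \<ge> Max (d ` {1..t}) + L.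
           int (w k) = (\<Sum>l=1..L. c l * int (w (k - l)))"
proof -
  let ?S = "gen_monom d a"
  have "finite (\<Union>i\<in>{1..t}. ?S i)" by (simp add: gen_monom_def)
  then obtain m0 where m0: "\<And>j. j \<in> (\<Union>i\<in>{1..t}. ?S i) \<Longrightarrow> j \<le> m0"
    by (meson finite_nat_set_iff_bounded_le)
  \<comment> \<open>A common bound for all indices; the successor makes \<open>m \<ge> 1\<close>
    evident.\<close>
  define m where "m = Suc m0"
  have S: "?S i \<subseteq> {1..m} \<and> 1 \<in> ?S i" if i: "i \<in> {1..t}" for i
  proof -
    have "j \<ge> 1" if "j \<in> ?S i" for j
      using that assms(3)[OF i] by (fastforce simp: gen_monom_def)
    moreover have "j \<le> m" if "j \<in> ?S i" for j
      using m0[of j] that i unfolding m_def by (meson UN_I le_SucI)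
    ultimately show ?thesis by (auto simp: gen_monom_def)
  qed
  let ?g = "\<lambda>u. \<Sum>i=1..t. \<Prod>j\<in>?S i. u ! (j - 1) :: bit"
  obtain p :: "int poly" where p: "degree p \<ge> 1" "coeff p (degree p) = 1"
    and kill: "\<And>k. k \<ge> m \<Longrightarrow> shift_apply p (\<lambda>k. int (card (cyclic_words m ?g k 1))) k = 0"
    using card_cyclic_words_recurrence[of m ?g 1] by (auto simp: m_def)
  have "shift_apply p (\<lambda>k. int (w k)) k = 0" if "k \<ge> 2 * m" for k
  proof -
    have "w (k + l) = card (cyclic_words m ?g (k + l) 1)" for l
      unfolding w_def by (rule wt_rs_fun_eq_card_cyclic_words[OF S]) (use that in simp_all)
    then have "shift_apply p (\<lambda>k. int (w k)) k = shift_apply p (\<lambda>k. int (card (cyclic_words m ?g k 1))) k"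
      by (simp only: shift_apply_def)
    then show ?thesis using kill[of k] that by simp
  qed
  \<comment> \<open>Here \<open>k0\<close> is \<open>2 * m\<close> and \<open>k1\<close> is the
    largest \<open>d i\<close>.\<close>
  then show ?thesis by (rule integer_recursion_of_shift_apply[OF p(2,1)])
qed

end
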